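(* Let $X,Y\in\mathcal{B}_A(\mathcal{H})$, $\alpha\in\mathbb{C}\setminus\{0\}$ and $\beta\ge 0$. Then $$\omega_{\mathbb{A}}^4\left(\begin{bmatrix} 0& X\\ Y& 0\end{bmatrix}\right)\le\frac{\delta_1}{4}\max\left\{\|X^{\sharp_A}X+YY^{\sharp_A}\|_A^2,\ \|XX^{\sharp_A}+Y^{\sharp_A}Y\|_A^2\right\}+\delta_2\max\left\{\omega_A^2(XY),\ \omega_A^2(YX)\right\},$$ where $\delta_1=\dfrac{2(\beta+1)\max\{1,|\alpha-1|^2\}+2\beta}{|\alpha|^2(\beta+1)}$ and $\delta_2=\dfrac{2}{|\alpha|^2(\beta+1)}$.
   Context: $\mathcal{H}$ is a complex Hilbert space, $\mathcal{B}(\mathcal{H})$ the bounded linear operators on it, and $A\in\mathcal{B}(\mathcal{H})$ is a fixed positive (semidefinite) operator. Put $\langle x,y\rangle_A=\langle Ax,y\rangle$ and $\|x\|_A=\langle x,x\rangle_A^{1/2}$. $\mathcal{B}_A(\mathcal{H})$ is the set of $T\in\mathcal{B}(\mathcal{H})$ for which there is $S\in\mathcal{B}(\mathcal{H})$ with $AS=T^*A$; for such $T$, $T^{\sharp_A}=A^\dagger T^*A$ ($A^\dagger$ the Moore-Penrose inverse), i.e. the unique bounded solution $S$ of $AS=T^*A$ with range in $\overline{\mathrm{ran}(A)}$. The $A$-operator seminorm is $\|T\|_A=\sup\{\|Tx\|_A/\|x\|_A : x\in\overline{\mathrm{ran}(A)},\ x\ne 0\}$, and the $A$-numerical radius is $\omega_A(T)=\sup\{|\langle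 Tx,x\rangle_A| : x\in\mathcal{H},\ \|x\|_A=1\}$. On $\mathcal{H}\oplus\mathcal{H}$ let $\mathbb{A}=\begin{bmatrix}A&0\\0&A\end{bmatrix}$; $\omega_{\mathbb{A}}$ is defined as $\omega_A$ with $\mathbb{A}$ in place of $A$. $\omega_A^s(T)$ means $(\omega_A(T))^s$. *)

theory Defs
  imports "HOL-Analysis.Analysis"
begin

text \<open>Complex Hilbert spaces, extending the real Banach space structure (and hence the topology)
  of the library. The inner product is linear in the first argument. Positive definiteness is
  part of \<open>cinner_self\<close>.\<close>

class chilbert_space = banach +
  fixes scaleC :: "complex \<Rightarrow> 'a \<Rightarrow> 'a" (infixr "*\<^sub>C" 75)
    and cinner :: "'a \<Rightarrow> 'a \<Rightarrow> complex"
  assumes scaleC_add_right: "c *\<^sub>C (x + y) = c *\<^sub>C x + c *\<^sub>C y"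
    and scaleC_add_left: "(c + d) *\<^sub>C x = c *\<^sub>C x + d *\<^sub>C x"
    and scaleC_scaleC: "c *\<^sub>C d *\<^sub>C x = (c * d) *\<^sub>C x"
    and scaleR_scaleC: "r *\<^sub>R x = complex_of_real r *\<^sub>C x"
    and cinner_commute: "cinner x y = cnj (cinner y x)"
    and cinner_add_left: "cinner (x + y) z = cinner x z + cinner y z"
    and cinner_scaleC_left: "cinner (c *\<^sub>C x) y = c * cinner x y"
    and cinner_self: "cinner x x = complex_of_real ((norm x)\<^sup>2)"

instantiation prod :: (chilbert_space, chilbert_space) chilbert_space
begin

definition scaleC_prod :: "complex \<Rightarrow> 'a \<times> 'b \<Rightarrow> 'a \<times> 'b"
  where "scaleC_prod c x = (c *\<^sub>C fst x, c *\<^sub>C snd x)"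

definition cinner_prod :: "'a \<times> 'b \<Rightarrow> 'a \<times> 'b \<Rightarrow> complex"
  where "cinner_prod x y = cinner (fst x) (fst y) + cinner (snd x) (snd y)"

instance
proof
  fix c d :: complex and r :: real and x y z :: "'a \<times> 'b"
  show "c *\<^sub>C (x + y) = c *\<^sub>C x + c *\<^sub>C y"
    by (simp add: scaleC_prod_def scaleC_add_right)
  show "(c + d) *\<^sub>C x = c *\<^sub>C x + d *\<^sub>C x"
    by (simp add: scaleC_prod_def scaleC_add_left)
  show "c *\<^sub>C d *\<^sub>C x = (c * d) *\<^sub>C x"
    by (simp add: scaleC_prod_def scaleC_scaleC)
  show "r *\<^sub>R x = complex_of_real r *\<^sub>C x"
    by (simp add: scaleC_prod_def scaleR_prod_def scaleR_scaleC)
  show "cinner x y = cnj (cinner y x)"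
    unfolding cinner_prod_def complex_cnj_add
    by (simp add: cinner_commute[symmetric])
  show "cinner (x + y) z = cinner x z + cinner y z"
    by (simp add: cinner_prod_def cinner_add_left)
  show "cinner (c *\<^sub>C x) y = c * cinner x y"
    by (simp add: cinner_prod_def scaleC_prod_def cinner_scaleC_left distrib_left)
  show "cinner x x = complex_of_real ((norm x)\<^sup>2)"
    by (simp add: cinner_prod_def cinner_self norm_prod_def)
qed

end

definition bounded_clinear :: "('a::chilbert_space \<Rightarrow> 'b::chilbert_space) \<Rightarrow> bool"
  where "bounded_clinear T \<longleftrightarrow> bounded_linear T \<and> (\<forall>c x. T (c *\<^sub>C x) = c *\<^sub>C T x)"

definition cadjoint :: "('a::chilbert_space \<Rightarrow> 'b::chilbert_space) \<Rightarrow> 'b \<Rightarrow> 'a"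
  where "cadjoint T = (THE S. bounded_clinear S \<and> (\<forall>x y. cinner (T x) y = cinner x (S y)))"

definition positive_op :: "('a::chilbert_space \<Rightarrow> 'a) \<Rightarrow> bool"
  where "positive_op A \<longleftrightarrow> bounded_clinear A \<and> (\<forall>x. cinner (A x) x \<in> \<real>\<^sub>\<ge>\<^sub>0)"

definition corthogonal_comp :: "'a::chilbert_space set \<Rightarrow> 'a set"
  where "corthogonal_comp S = {x. \<forall>y\<in>S. cinner x y = 0}"

text \<open>The Moore-Penrose inverse is in general an unbounded operator with domain
  ran \<open>A\<close> \<open>\<oplus>\<close> (ran \<open>A\<close>)\<open>\<^sup>\<bottom>\<close>. It sends such a \<open>y\<close> to the unique \<open>x\<close> in (ker \<open>A\<close>)\<open>\<^sup>\<bottom>\<close>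
  for which \<open>A x\<close> is the orthogonal projection of \<open>y\<close> onto the closure of ran \<open>A\<close>.
  Off this domain the value is unspecified.\<close>

definition mp_inverse :: "('a::chilbert_space \<Rightarrow> 'b::chilbert_space) \<Rightarrow> 'b \<Rightarrow> 'a"
  where "mp_inverse A y =
    (THE x. x \<in> corthogonal_comp {z. A z = 0} \<and> y - A x \<in> corthogonal_comp (range A))"

definition semi_inner :: "('a::chilbert_space \<Rightarrow> 'a) \<Rightarrow> 'a \<Rightarrow> 'a \<Rightarrow> complex"
  where "semi_inner A x y = cinner (A x) y"

text \<open>For positive \<open>A\<close> the number \<open>semi_inner A x x\<close> is real and nonnegative.\<close>

definition semi_norm :: "('a::chilbert_space \<Rightarrow> 'a) \<Rightarrow> 'a \<Rightarrow> real"
  where "semi_norm A x = sqrt (Re (semi_inner A x x))"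

definition adjointable_ops :: "('a::chilbert_space \<Rightarrow> 'a) \<Rightarrow> ('a \<Rightarrow> 'a) set"
  where "adjointable_ops A =
    {T. bounded_clinear T \<and> (\<exists>S. bounded_clinear S \<and> A \<circ> S = cadjoint T \<circ> A)}"

definition sharp :: "('a::chilbert_space \<Rightarrow> 'a) \<Rightarrow> ('a \<Rightarrow> 'a) \<Rightarrow> 'a \<Rightarrow> 'a"
  where "sharp A T = mp_inverse A \<circ> cadjoint T \<circ> A"

text \<open>In the next two definitions all quantities are nonnegative, and inserting \<open>0\<close> only
  fixes the supremum of the empty set, which occurs for \<open>A = 0\<close>, as \<open>0\<close>. For \<open>T\<close> in
  \<open>adjointable_ops A\<close> both sets are bounded above.\<close>

definition op_seminorm :: "('a::chilbert_space \<Rightarrow> 'a) \<Rightarrow> ('a \<Rightarrow> 'a) \<Rightarrow> real"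
  where "op_seminorm A T =
    Sup (insert 0 {semi_norm A (T x) / semi_norm A x | x. x \<in> closure (range A) \<and> x \<noteq> 0})"

definition num_radius :: "('a::chilbert_space \<Rightarrow> 'a) \<Rightarrow> ('a \<Rightarrow> 'a) \<Rightarrow> real"
  where "num_radius A T =
    Sup (insert 0 {cmod (semi_inner A (T x) x) | x. semi_norm A x = 1})"

definition block_op ::
    "('a::chilbert_space \<Rightarrow> 'a) \<Rightarrow> ('a \<Rightarrow> 'a) \<Rightarrow> ('a \<Rightarrow> 'a) \<Rightarrow> ('a \<Rightarrow> 'a) \<Rightarrow> 'a \<times> 'a \<Rightarrow> 'a \<times> 'a"
  where "block_op P Q R S = (\<lambda>(x, y). (P x + Q y, R x + S y))"

end

theory Submission
  imports Defs
begin

text \<open>Let \<open>T\<close> be the off-diagonal block operator, \<open>T'\<close> its adjoint for the block semi-inner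
  product and \<open>z\<close> a unit vector. The extended Buzano inequality bounds
  \<open>\<bar>\<langle>Tz, z\<rangle>\<bar>\<^sup>2 = \<bar>\<langle>Tz, z\<rangle>\<langle>z, T'z\<rangle>\<bar>\<close> by \<open>(max {1, \<bar>\<alpha> - 1\<bar>} \<parallel>Tz\<parallel> \<parallel>T'z\<parallel> + \<bar>\<langle>T\<^sup>2z, z\<rangle>\<bar>) / \<bar>\<alpha>\<bar>\<close>.
  After squaring, a fraction \<open>\<beta> / (\<beta> + 1)\<close> of \<open>\<bar>\<langle>T\<^sup>2z, z\<rangle>\<bar>\<^sup>2\<close> is absorbed into \<open>\<parallel>Tz\<parallel>\<^sup>2 \<parallel>T'z\<parallel>\<^sup>2\<close> by
  Cauchy-Schwarz, and the latter is at most \<open>\<langle>(T'T + TT')z, z\<rangle>\<^sup>2 / 4\<close>. Both \<open>T\<^sup>2\<close> and \<open>T'T + TT'\<close> are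
  block diagonal. That all suprema are finite rests on the \<open>A\<close>-boundedness of operators
  with an \<open>A\<close>-adjoint.\<close>

section \<open>Sesquilinear algebra\<close>

lemma cinner_zero_left [simp]: "cinner 0 x = 0"
  using cinner_add_left[of 0 0 x] by simp

lemma cinner_minus_left: "cinner (- x) y = - cinner x y"
  using cinner_add_left[of x "- x" y] by (simp add: eq_neg_iff_add_eq_0 add.commute)

lemma cinner_diff_left: "cinner (x - y) z = cinner x z - cinner y z"
  using cinner_add_left[of x "- y" z] by (simp add: cinner_minus_left)

lemma cinner_add_right: "cinner x (y + z) = cinner x y + cinner x z"
  by (metis cinner_commute cinner_add_left complex_cnj_add)

lemma cinner_diff_right: "cinner x (y - z) = cinner x y - cinner x z"
  by (metis cinner_commute cinner_diff_left complex_cnj_diff)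

lemma cinner_scaleC_right: "cinner x (c *\<^sub>C y) = cnj c * cinner x y"
  by (metis cinner_commute cinner_scaleC_left complex_cnj_mult)

lemma cinner_zero_right [simp]: "cinner x 0 = 0"
  using cinner_add_right[of x 0 0] by simp

lemma cinner_self_eq_0 [simp]: "cinner x x = 0 \<longleftrightarrow> x = 0"
  by (simp add: cinner_self)

lemma bounded_clinear_add: "bounded_clinear T \<Longrightarrow> T (x + y) = T x + T y"
  by (simp add: bounded_clinear_def linear_simps)

lemma bounded_clinear_diff: "bounded_clinear T \<Longrightarrow> T (x - y) = T x - T y"
  by (simp add: bounded_clinear_def linear_simps)

lemma bounded_clinear_zero: "bounded_clinear T \<Longrightarrow> T 0 = 0"
  by (simp add: bounded_clinear_def linear_simps)

lemma bounded_clinear_scaleC: "bounded_clinear T \<Longrightarrow> T (c *\<^sub>C x) = c *\<^sub>C T x"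
  by (simp add: bounded_clinear_def)

lemma bounded_clinear_compose:
  "bounded_clinear S \<Longrightarrow> bounded_clinear T \<Longrightarrow> bounded_clinear (S \<circ> T)"
  by (auto simp: bounded_clinear_def o_def intro: bounded_linear_compose)

section \<open>The semi-inner product of a positive operator: Cauchy-Schwarz and Buzano
  inequalities\<close>

context
  fixes A :: "'a::chilbert_space \<Rightarrow> 'a"
  assumes pos: "positive_op A"
begin

lemma positive_op_bounded_clinear: "bounded_clinear A"
  using pos by (simp add: positive_op_def)

lemma semi_inner_add_left: "semi_inner A (x + y) z = semi_inner A x z + semi_inner A y z"
  by (simp add: semi_inner_def bounded_clinear_add[OF positive_op_bounded_clinear] cinner_add_left)

lemma semi_inner_add_right: "semi_inner A x (y + z) = semi_inner A x y + semi_inner A x z"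
  by (simp add: semi_inner_def cinner_add_right)

lemma semi_inner_diff_left: "semi_inner A (x - y) z = semi_inner A x z - semi_inner A y z"
  by (simp add: semi_inner_def bounded_clinear_diff[OF positive_op_bounded_clinear] cinner_diff_left)

lemma semi_inner_diff_right: "semi_inner A x (y - z) = semi_inner A x y - semi_inner A x z"
  by (simp add: semi_inner_def cinner_diff_right)

lemma semi_inner_scaleC_left: "semi_inner A (c *\<^sub>C x) y = c * semi_inner A x y"
  by (simp add: semi_inner_def bounded_clinear_scaleC[OF positive_op_bounded_clinear] cinner_scaleC_left)

lemma semi_inner_scaleC_right: "semi_inner A x (c *\<^sub>C y) = cnj c * semi_inner A x y"
  by (simp add: semi_inner_def cinner_scaleC_right)

lemma semi_inner_self_nonneg: "semi_inner A x x \<in> \<real>\<^sub>\<ge>\<^sub>0"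
  using pos by (simp add: positive_op_def semi_inner_def)

lemma semi_inner_self: "semi_inner A x x = complex_of_real ((semi_norm A x)\<^sup>2)"
  using semi_inner_self_nonneg[of x]
  by (simp add: semi_norm_def complex_nonneg_Reals_iff complex_eq_iff)

lemma semi_norm_nonneg [simp]: "semi_norm A x \<ge> 0"
  using semi_inner_self_nonneg[of x] by (simp add: semi_norm_def complex_nonneg_Reals_iff)

lemma semi_norm_sq: "(semi_norm A x)\<^sup>2 = Re (semi_inner A x x)"
  by (simp add: semi_inner_self del: of_real_power)

text \<open>Polarization: reality of the form at \<open>x + y\<close> matches the imaginary parts,
  reality at \<open>x + \<i> *\<^sub>C y\<close> the real parts. Positivity of \<open>A\<close>
  alone thus yields Hermitian symmetry.\<close>

lemma semi_inner_commute: "semi_inner A x y = cnj (semi_inner A y x)"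
proof -
  have "Im (semi_inner A (x + y) (x + y)) = 0"
    and "Im (semi_inner A (x + \<i> *\<^sub>C y) (x + \<i> *\<^sub>C y)) = 0"
    and "Im (semi_inner A x x) = 0" and "Im (semi_inner A y y) = 0"
    by (simp_all add: semi_inner_self del: of_real_power)
  then show ?thesis
    by (auto simp: semi_inner_add_left semi_inner_add_right semi_inner_scaleC_left
        semi_inner_scaleC_right complex_eq_iff)
qed

lemma semi_norm_scaleC: "semi_norm A (c *\<^sub>C x) = cmod c * semi_norm A x"
proof -
  have "complex_of_real ((semi_norm A (c *\<^sub>C x))\<^sup>2) = c * (cnj c * complex_of_real ((semi_norm A x)\<^sup>2))"
    by (simp only: semi_inner_self[symmetric] semi_inner_scaleC_left semi_inner_scaleC_right mult_ac)
  also have "\<dots> = complex_of_real ((cmod c * semi_norm A x)\<^sup>2)"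
    by (simp add: power_mult_distrib complex_norm_square mult_ac del: of_real_power)
  finally show ?thesis
    by (simp only: of_real_eq_iff) (simp add: power2_eq_iff_nonneg)
qed

lemma semi_norm_diff_sq:
  "(semi_norm A (x - y))\<^sup>2 = (semi_norm A x)\<^sup>2 - 2 * Re (semi_inner A x y) + (semi_norm A y)\<^sup>2"
  using semi_inner_commute[of y x]
  by (simp add: semi_norm_sq semi_inner_diff_left semi_inner_diff_right)

lemma semi_norm_add_sq:
  "(semi_norm A (x + y))\<^sup>2 = (semi_norm A x)\<^sup>2 + 2 * Re (semi_inner A x y) + (semi_norm A y)\<^sup>2"
  using semi_inner_commute[of y x]
  by (simp add: semi_norm_sq semi_inner_add_left semi_inner_add_right)

text \<open>The coefficient of \<open>y\<close> carries the phase of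
  \<open>semi_inner A x y\<close>, so only a real parameter \<open>t\<close> is left to optimize.
  This serves both Cauchy-Schwarz and the variational step for nearest points.\<close>

lemma semi_norm_diff_scaleC_sq:
  "(semi_norm A (x - (of_real t * semi_inner A x y) *\<^sub>C y))\<^sup>2
    = (semi_norm A x)\<^sup>2 - 2 * t * (cmod (semi_inner A x y))\<^sup>2
      + t\<^sup>2 * (cmod (semi_inner A x y))\<^sup>2 * (semi_norm A y)\<^sup>2"
  unfolding semi_norm_diff_sq semi_inner_scaleC_right semi_norm_scaleC
  by (simp add: power_mult_distrib norm_mult cmod_power2) (simp add: power2_eq_square algebra_simps)

lemma Cauchy_Schwarz_semi_inner: "cmod (semi_inner A x y) \<le> semi_norm A x * semi_norm A y"
proof -
  define s where "s = cmod (semi_inner A x y)"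
  define a where "a = semi_norm A x"
  define b where "b = semi_norm A y"
  have q: "0 \<le> a\<^sup>2 - 2 * t * s\<^sup>2 + t\<^sup>2 * s\<^sup>2 * b\<^sup>2" for t
    using semi_norm_diff_scaleC_sq[of x t y] unfolding s_def a_def b_def
    by (metis zero_le_power2)
  have "s\<^sup>2 \<le> (a * b)\<^sup>2"
  proof (cases "b = 0")
    case True
    have "s = 0"
    proof (rule ccontr)
      \<comment> \<open>With \<open>b = 0\<close> the quadratic in \<open>q\<close> is affine in
        \<open>t\<close> with negative slope; this \<open>t\<close> gives it the value -1.\<close>
      assume "s \<noteq> 0"
      then have "2 * ((a\<^sup>2 + 1) / (2 * s\<^sup>2)) * s\<^sup>2 = a\<^sup>2 + 1"
        by simp
      then show False
        using q[of "(a\<^sup>2 + 1) / (2 * s\<^sup>2)"] True by simp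
    qed
    then show ?thesis by simp
  next
    case False
    \<comment> \<open>The quadratic is evaluated at \<open>1 / b\<^sup>2\<close>, its minimizer when
      \<open>s\<close> is nonzero.\<close>
    then have "0 \<le> a\<^sup>2 - s\<^sup>2 / b\<^sup>2"
      using q[of "1 / b\<^sup>2"] by (simp add: power2_eq_square)
    then show ?thesis
      using False by (simp add: power_mult_distrib pos_divide_le_eq)
  qed
  then show ?thesis
    unfolding s_def a_def b_def by (rule power2_le_imp_le) simp
qed

lemma semi_norm_triangle: "semi_norm A (x + y) \<le> semi_norm A x + semi_norm A y"
proof (rule power2_le_imp_le)
  have "Re (semi_inner A x y) \<le> semi_norm A x * semi_norm A y"
    using Cauchy_Schwarz_semi_inner complex_Re_le_cmod order_trans by blast
  then show "(semi_norm A (x + y))\<^sup>2 \<le> (semi_norm A x + semi_norm A y)\<^sup>2"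
    by (simp add: semi_norm_add_sq power2_sum)
qed simp

text \<open>Pairing \<open>z = x - (\<alpha> * c) *\<^sub>C e\<close> with \<open>y\<close> isolates
  \<open>\<alpha> * c * semi_inner A e y\<close>, so it suffices to bound the seminorm of
  \<open>z\<close> by \<open>m\<close> times that of \<open>x\<close>. The choice \<alpha> = 2 is
  the classical Buzano inequality.\<close>

lemma Buzano_semi_inner:
  assumes "semi_norm A e = 1" and "\<alpha> \<noteq> 0"
  shows "cmod (semi_inner A x e) * cmod (semi_inner A e y)
    \<le> (max 1 (cmod (\<alpha> - 1)) * (semi_norm A x * semi_norm A y) + cmod (semi_inner A x y)) / cmod \<alpha>"
proof -
  define m where "m = max 1 (cmod (\<alpha> - 1))"
  define c where "c = semi_inner A x e"
  define z where "z = x - (\<alpha> * c) *\<^sub>C e"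
  have "(semi_norm A z)\<^sup>2 = (semi_norm A x)\<^sup>2 - 2 * Re (cnj \<alpha>) * (cmod c)\<^sup>2 + (cmod \<alpha>)\<^sup>2 * (cmod c)\<^sup>2"
    unfolding z_def semi_norm_diff_sq semi_inner_scaleC_right semi_norm_scaleC c_def[symmetric] assms(1)
    by (simp add: power_mult_distrib norm_mult cmod_power2) (simp add: power2_eq_square algebra_simps)
  \<comment> \<open>Pythagoras for \<open>z\<close>: the part of \<open>x\<close> orthogonal to
    \<open>e\<close> is kept, the part along \<open>e\<close> is scaled by
    \<open>1 - \<alpha>\<close>. Both factors have modulus at most \<open>m\<close>.\<close>
  also have "\<dots> = ((semi_norm A x)\<^sup>2 - (cmod c)\<^sup>2) + (cmod (\<alpha> - 1))\<^sup>2 * (cmod c)\<^sup>2"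
    by (simp add: cmod_power2) (simp add: power2_eq_square algebra_simps)
  also have "\<dots> \<le> m\<^sup>2 * ((semi_norm A x)\<^sup>2 - (cmod c)\<^sup>2) + m\<^sup>2 * (cmod c)\<^sup>2"
  proof (rule add_mono)
    have "cmod c \<le> semi_norm A x"
      using Cauchy_Schwarz_semi_inner[of x e] assms(1) by (simp add: c_def)
    then have "0 \<le> (semi_norm A x)\<^sup>2 - (cmod c)\<^sup>2"
      by (simp add: power_mono)
    moreover have "1 \<le> m\<^sup>2"
      by (simp add: m_def one_le_power)
    ultimately show "(semi_norm A x)\<^sup>2 - (cmod c)\<^sup>2 \<le> m\<^sup>2 * ((semi_norm A x)\<^sup>2 - (cmod c)\<^sup>2)"
      using mult_right_mono by fastforce
    show "(cmod (\<alpha> - 1))\<^sup>2 * (cmod c)\<^sup>2 \<le> m\<^sup>2 * (cmod c)\<^sup>2"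
      by (intro mult_right_mono power_mono) (auto simp: m_def)
  qed
  finally have "(semi_norm A z)\<^sup>2 \<le> (m * semi_norm A x)\<^sup>2"
    by (simp add: power_mult_distrib algebra_simps)
  then have z: "semi_norm A z \<le> m * semi_norm A x"
    by (rule power2_le_imp_le) (simp add: m_def)
  have "\<alpha> * (c * semi_inner A e y) = semi_inner A x y - semi_inner A z y"
    by (simp add: z_def semi_inner_diff_left semi_inner_scaleC_left)
  then have "cmod \<alpha> * (cmod c * cmod (semi_inner A e y)) \<le> cmod (semi_inner A x y) + cmod (semi_inner A z y)"
    by (metis norm_mult norm_triangle_ineq4)
  moreover have "cmod (semi_inner A z y) \<le> m * (semi_norm A x * semi_norm A y)"
    using Cauchy_Schwarz_semi_inner[of z y] mult_right_mono[OF z semi_norm_nonneg[of y]]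
    by (simp add: mult.assoc)
  ultimately have "cmod c * cmod (semi_inner A e y) * cmod \<alpha>
      \<le> m * (semi_norm A x * semi_norm A y) + cmod (semi_inner A x y)"
    by (simp add: mult_ac)
  then show ?thesis
    using assms(2) unfolding m_def c_def by (subst pos_le_divide_eq) simp_all
qed

end

text \<open>With the identity as positive operator, the results on semi-inner products specialize to
  \<open>cinner\<close> and \<open>norm\<close>.\<close>

lemma positive_op_ident: "positive_op (\<lambda>x::'a::chilbert_space. x)"
  by (simp add: positive_op_def bounded_clinear_def cinner_self complex_nonneg_Reals_iff
      del: of_real_power)

lemma semi_norm_ident: "semi_norm (\<lambda>x. x) x = norm x"
  by (simp add: semi_norm_def semi_inner_def cinner_self del: of_real_power)

lemma norm_scaleC: "norm (c *\<^sub>C x) = cmod c * norm (x::'a::chilbert_space)"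
  using semi_norm_scaleC[OF positive_op_ident, of c x] by (simp add: semi_norm_ident)

lemma Cauchy_Schwarz_cinner: "cmod (cinner x y) \<le> norm x * norm y"
  using Cauchy_Schwarz_semi_inner[OF positive_op_ident, of x y]
  by (simp add: semi_norm_ident semi_inner_def)

section \<open>Orthogonal projection, Riesz representation and adjoints\<close>

lemma cinner_parallelogram:
  "(norm (x + y))\<^sup>2 + (norm (x - y))\<^sup>2 = 2 * (norm x)\<^sup>2 + 2 * (norm (y::'a::chilbert_space))\<^sup>2"
  using semi_norm_diff_sq[OF positive_op_ident, of x y] semi_norm_add_sq[OF positive_op_ident, of x y]
  by (simp add: semi_norm_ident)

text \<open>A sequence in \<open>M\<close> minimizing the distance to \<open>x\<close> is Cauchy by
  the parallelogram law; moving its limit within \<open>M\<close> cannot reduce the distance, which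
  forces orthogonality.\<close>

lemma orthogonal_projection_exists:
  fixes M :: "'a::chilbert_space set"
  assumes "closed M" and "0 \<in> M"
    and add: "\<And>x y. x \<in> M \<Longrightarrow> y \<in> M \<Longrightarrow> x + y \<in> M"
    and scale: "\<And>c x. x \<in> M \<Longrightarrow> c *\<^sub>C x \<in> M"
  obtains p where "p \<in> M" and "x - p \<in> corthogonal_comp M"
proof -
  define d where "d = infdist x M"
  have d0: "d \<ge> 0" by (simp add: d_def infdist_nonneg)
  have dle: "d \<le> norm (x - y)" if "y \<in> M" for y
    using infdist_le[OF that, of x] by (simp add: d_def dist_norm)
  have "\<exists>p\<in>M. (norm (x - p))\<^sup>2 < d\<^sup>2 + 1 / real (Suc n)" for n
  proof -
    have "d < sqrt (d\<^sup>2 + 1 / real (Suc n))"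
      using d0 by (intro real_less_rsqrt) simp
    moreover have "d = (INF y\<in>M. norm (x - y))"
      using assms(2) by (auto simp: d_def infdist_def dist_norm)
    moreover have "bdd_below ((\<lambda>y. norm (x - y)) ` M)"
      by (rule bdd_belowI2[of _ 0]) simp
    ultimately obtain p where "p \<in> M" and p: "norm (x - p) < sqrt (d\<^sup>2 + 1 / real (Suc n))"
      using assms(2) cINF_less_iff[of M] by (metis empty_iff)
    from p have "(norm (x - p))\<^sup>2 < (sqrt (d\<^sup>2 + 1 / real (Suc n)))\<^sup>2"
      by (rule power_strict_mono) simp_all
    then show ?thesis
      using \<open>p \<in> M\<close> by (subst (asm) real_sqrt_pow2) auto
  qed
  then obtain p where pM: "\<And>n. p n \<in> M" and p: "\<And>n. (norm (x - p n))\<^sup>2 < d\<^sup>2 + 1 / real (Suc n)"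
    by metis
  have close: "(norm (p m - p n))\<^sup>2 < 2 / real (Suc m) + 2 / real (Suc n)" for m n
  proof -
    \<comment> \<open>The midpoint also lies in \<open>M\<close>, hence at distance at least
      \<open>d\<close> from \<open>x\<close>; this bounds the sum term of the parallelogram law from
      below.\<close>
    have "(1/2::complex) *\<^sub>C (p m + p n) \<in> M"
      by (intro scale add pM)
    moreover have "(1/2::complex) *\<^sub>C (p m + p n) = (1/2::real) *\<^sub>R (p m + p n)"
      by (simp add: scaleR_scaleC)
    ultimately have "d \<le> norm (x - (1/2::real) *\<^sub>R (p m + p n))"
      using dle by simp
    also have "x - (1/2::real) *\<^sub>R (p m + p n) = (1/2::real) *\<^sub>R ((x - p m) + (x - p n))"
      by (simp add: algebra_simps flip: scaleR_add_left)
    finally have "2 * d \<le> norm ((x - p m) + (x - p n))"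
      by simp
    then have "4 * d\<^sup>2 \<le> (norm ((x - p m) + (x - p n)))\<^sup>2"
      using d0 power_mono[of "2 * d" _ 2] by (simp add: power_mult_distrib)
    moreover have "norm ((x - p m) - (x - p n)) = norm (p m - p n)"
      by (simp add: norm_minus_commute)
    ultimately show ?thesis
      using cinner_parallelogram[of "x - p m" "x - p n"] p[of m] p[of n] by simp
  qed
  have "Cauchy p"
  proof (rule CauchyI)
    fix e :: real assume "e > 0"
    \<comment> \<open>The bound in \<open>close\<close> amounts to at most four terms
      \<open>1 / real (Suc N)\<close>, hence the quarter of \<open>e\<^sup>2\<close>.\<close>
    then obtain N where N: "1 / real (Suc N) < e\<^sup>2 / 4"
      using reals_Archimedean[of "e\<^sup>2 / 4"] by (auto simp: inverse_eq_divide)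
    have "norm (p m - p n) < e" if "m \<ge> N" "n \<ge> N" for m n
    proof (rule power2_less_imp_less)
      have "1 / real (Suc m) \<le> 1 / real (Suc N)" "1 / real (Suc n) \<le> 1 / real (Suc N)"
        using that by (simp_all add: frac_le)
      then show "(norm (p m - p n))\<^sup>2 < e\<^sup>2"
        using close[of m n] N by simp
    qed (use \<open>e > 0\<close> in simp)
    then show "\<exists>N. \<forall>m\<ge>N. \<forall>n\<ge>N. norm (p m - p n) < e" by blast
  qed
  then obtain l where l: "p \<longlonglongrightarrow> l"
    using Cauchy_convergent_iff convergent_def by blast
  have lM: "l \<in> M"
    using closed_sequentially[OF assms(1) _ l] pM by blast
  have "(norm (x - l))\<^sup>2 \<le> d\<^sup>2"
  proof (rule LIMSEQ_le)
    show "(\<lambda>n. (norm (x - p n))\<^sup>2) \<longlonglongrightarrow> (norm (x - l))\<^sup>2"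
      by (intro tendsto_intros l)
    show "(\<lambda>n. d\<^sup>2 + 1 / real (Suc n)) \<longlonglongrightarrow> d\<^sup>2"
      using tendsto_add[OF tendsto_const[of "d\<^sup>2"] LIMSEQ_inverse_real_of_nat]
      by (simp add: inverse_eq_divide)
    show "\<exists>N. \<forall>n\<ge>N. (norm (x - p n))\<^sup>2 \<le> d\<^sup>2 + 1 / real (Suc n)"
      using p less_imp_le by blast
  qed
  then have ld: "norm (x - l) \<le> d"
    using d0 by (rule power2_le_imp_le)
  have "x - l \<in> corthogonal_comp M"
    unfolding corthogonal_comp_def
  proof (intro CollectI ballI)
    fix y assume "y \<in> M"
    define s where "s = cmod (cinner (x - l) y)"
    show "cinner (x - l) y = 0"
    proof (cases "y = 0")
      case False
      \<comment> \<open>For this \<open>t\<close> the displacement is the projection of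
        \<open>x - l\<close> onto \<open>y\<close>, and it would lower the squared distance by
        \<open>s\<^sup>2 / (norm y)\<^sup>2\<close>.\<close>
      define t where "t = 1 / (norm y)\<^sup>2"
      have "l + (of_real t * cinner (x - l) y) *\<^sub>C y \<in> M"
        by (intro add scale lM \<open>y \<in> M\<close>)
      from dle[OF this] ld have "norm (x - l) \<le> norm (x - l - (of_real t * cinner (x - l) y) *\<^sub>C y)"
        by (simp add: diff_diff_eq)
      then have "(norm (x - l))\<^sup>2 \<le> (norm (x - l - (of_real t * cinner (x - l) y) *\<^sub>C y))\<^sup>2"
        by (simp add: power_mono)
      also have "\<dots> = (norm (x - l))\<^sup>2 - 2 * t * s\<^sup>2 + t\<^sup>2 * s\<^sup>2 * (norm y)\<^sup>2"
        using semi_norm_diff_scaleC_sq[OF positive_op_ident, of "x - l" t y]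
        by (simp add: semi_norm_ident semi_inner_def s_def)
      also have "\<dots> = (norm (x - l))\<^sup>2 - s\<^sup>2 / (norm y)\<^sup>2"
        using False by (simp add: t_def field_simps power2_eq_square)
      finally have "s\<^sup>2 / (norm y)\<^sup>2 \<le> 0" by simp
      then have "s = 0"
        using False by (simp add: divide_le_0_iff)
      then show ?thesis by (simp add: s_def)
    qed simp
  qed
  with lM that show ?thesis by blast
qed

text \<open>If \<open>f\<close> is not zero, a vector \<open>w\<close> orthogonal to its closed
  kernel spans the remaining direction; subtracting a multiple of \<open>w\<close> brings any
  \<open>x\<close> into the kernel, and a rescaled \<open>w\<close> represents
  \<open>f\<close>.\<close>

lemma Riesz_representation:
  fixes f :: "'a::chilbert_space \<Rightarrow> complex"
  assumes f: "bounded_linear f" and scale: "\<And>c x. f (c *\<^sub>C x) = c * f x"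
  obtains y where "\<And>x. f x = cinner x y"
proof (cases "\<forall>x. f x = 0")
  case True
  then show ?thesis using that[of 0] by simp
next
  case False
  then obtain x\<^sub>0 where x0: "f x\<^sub>0 \<noteq> 0" by blast
  interpret f: bounded_linear f by (fact f)
  have "closed {x. f x = 0}"
    by (intro closed_Collect_eq continuous_intros f.continuous_on)
  then obtain p where p: "f p = 0" and orth: "x\<^sub>0 - p \<in> corthogonal_comp {x. f x = 0}"
    by (rule orthogonal_projection_exists[where x = x\<^sub>0]) (auto simp: f.add f.zero scale)
  define w where "w = x\<^sub>0 - p"
  have fw: "f w \<noteq> 0"
    using x0 p by (simp add: w_def f.diff)
  then have w0: "norm w \<noteq> 0" by (auto simp: f.zero)
  have "f x = cinner x ((cnj (f w) / of_real ((norm w)\<^sup>2)) *\<^sub>C w)" for x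
  proof -
    have "f (x - (f x / f w) *\<^sub>C w) = 0"
      using fw by (simp add: f.diff scale)
    then have "cinner w (x - (f x / f w) *\<^sub>C w) = 0"
      using orth by (simp add: corthogonal_comp_def w_def)
    then have "cinner (x - (f x / f w) *\<^sub>C w) w = 0"
      by (metis cinner_commute complex_cnj_zero)
    then have "cinner x w = f x / f w * of_real ((norm w)\<^sup>2)"
      by (simp add: cinner_diff_left cinner_scaleC_left cinner_self)
    then show ?thesis
      using fw w0 by (simp add: cinner_scaleC_right)
  qed
  with that show ?thesis by blast
qed

lemma cinner_ext: "(\<And>x. cinner x y = cinner x z) \<Longrightarrow> y = z"
  by (metis cinner_diff_right cinner_self_eq_0 eq_iff_diff_eq_0)

text \<open>As \<open>cadjoint\<close> is a definite description, its equation is available only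
  after existence and uniqueness: Riesz gives the values pointwise, and \<open>cinner_ext\<close>
  gives linearity and uniqueness.\<close>

lemma cinner_cadjoint:
  fixes T :: "'a::chilbert_space \<Rightarrow> 'b::chilbert_space"
  assumes T: "bounded_clinear T"
  shows "cinner (T x) y = cinner x (cadjoint T y)"
proof -
  obtain K where K: "\<And>x. norm (T x) \<le> norm x * K" and K0: "K \<ge> 0"
    using T bounded_linear.nonneg_bounded unfolding bounded_clinear_def by blast
  have "\<exists>z. \<forall>x. cinner (T x) y = cinner x z" for y
  proof -
    have "bounded_linear (\<lambda>x. cinner (T x) y)"
    proof (rule bounded_linear_intro)
      show "cinner (T (u + v)) y = cinner (T u) y + cinner (T v) y" for u v
        by (simp add: bounded_clinear_add[OF T] cinner_add_left)
      show "cinner (T (r *\<^sub>R u)) y = r *\<^sub>R cinner (T u) y" for r u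
        by (simp add: scaleR_scaleC bounded_clinear_scaleC[OF T] cinner_scaleC_left scaleR_conv_of_real)
      show "cmod (cinner (T u) y) \<le> norm u * (K * norm y)" for u
        using Cauchy_Schwarz_cinner[of "T u" y] mult_right_mono[OF K[of u] norm_ge_zero[of y]]
        by (simp add: mult.assoc)
    qed
    then show ?thesis
      by (rule Riesz_representation)
        (auto simp: bounded_clinear_scaleC[OF T] cinner_scaleC_left)
  qed
  then obtain S where S: "\<And>x y. cinner (T x) y = cinner x (S y)" by metis
  have "bounded_clinear S"
    unfolding bounded_clinear_def
  proof (intro conjI allI bounded_linear_intro)
    show "S (u + v) = S u + S v" for u v
      by (rule cinner_ext) (simp add: S[symmetric] cinner_add_right)
    show scale: "S (c *\<^sub>C u) = c *\<^sub>C S u" for c u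
      by (rule cinner_ext) (simp add: S[symmetric] cinner_scaleC_right)
    show "S (r *\<^sub>R u) = r *\<^sub>R S u" for r u
      by (simp add: scaleR_scaleC scale)
    show "norm (S u) \<le> norm u * K" for u
    proof (cases "S u = 0")
      case False
      \<comment> \<open>One factor \<open>norm (S u)\<close> will cancel, so \<open>S\<close>
        inherits the bound \<open>K\<close> of \<open>T\<close>.\<close>
      have "(norm (S u))\<^sup>2 = cmod (cinner (T (S u)) u)"
        by (simp add: S cinner_self del: of_real_power)
      also have "\<dots> \<le> norm (S u) * K * norm u"
        using Cauchy_Schwarz_cinner[of "T (S u)" u] mult_right_mono[OF K[of "S u"] norm_ge_zero[of u]]
        by linarith
      finally show ?thesis
        using False by (simp add: power2_eq_square mult.assoc mult.commute[of K])
    qed (simp add: K0)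
  qed
  moreover have "S' = S" if "\<forall>x y. cinner (T x) y = cinner x (S' y)" for S'
    by (rule ext, rule cinner_ext) (simp add: that[rule_format, symmetric] S)
  ultimately have "\<exists>!S. bounded_clinear S \<and> (\<forall>x y. cinner (T x) y = cinner x (S y))"
    using S by blast
  from theI'[OF this] show ?thesis
    unfolding cadjoint_def by blast
qed

section \<open>Operators admitting an adjoint for a positive operator\<close>

context
  fixes A :: "'a::chilbert_space \<Rightarrow> 'a"
  assumes pos: "positive_op A"
begin

lemma positive_op_selfadjoint: "cinner (A x) y = cinner x (A y)"
  using semi_inner_commute[OF pos, of x y] cinner_commute[of x "A y"]
  by (simp add: semi_inner_def)

lemma semi_norm_eq_0_if_kernel: "A x = 0 \<Longrightarrow> semi_norm A x = 0"
  by (simp add: semi_norm_def semi_inner_def)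

lemma kernel_iff_corthogonal_range: "A x = 0 \<longleftrightarrow> x \<in> corthogonal_comp (range A)"
  unfolding corthogonal_comp_def
  using positive_op_selfadjoint[of x] cinner_self_eq_0[of "A x"] by force

text \<open>Both descriptions of \<open>p\<close> are needed: the closed range is where
  \<open>op_seminorm\<close> takes its supremum, orthogonality to the kernel is what
  \<open>mp_inverse\<close> asks for.\<close>

lemma range_kernel_decomposition:
  obtains p k where "x = p + k" and "p \<in> closure (range A)" and "A k = 0"
    and "p \<in> corthogonal_comp {z. A z = 0}"
proof -
  note A = positive_op_bounded_clinear[OF pos]
  have A_linear: "bounded_linear A"
    using A by (simp add: bounded_clinear_def)
  have perp_closure: "cinner y z = 0" if "y \<in> closure (range A)" "A z = 0" for y z
  proof -
    have "bounded_linear (\<lambda>y. cinner y z)"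
      by (rule bounded_linear_intro[where K = "norm z"])
        (simp_all add: cinner_add_left scaleR_scaleC cinner_scaleC_left scaleR_conv_of_real
          Cauchy_Schwarz_cinner)
    then have "closed {y. cinner y z = 0}"
      by (intro closed_Collect_eq continuous_intros linear_continuous_on)
    moreover have "range A \<subseteq> {y. cinner y z = 0}"
      using positive_op_selfadjoint that(2) by auto
    ultimately show ?thesis
      using that(1) closure_minimal by blast
  qed
  have lim: "(\<exists>y. (\<forall>n. y n \<in> range A) \<and> y \<longlonglongrightarrow> u)" if "u \<in> closure (range A)" for u
    using that closure_sequential by metis
  have zero: "0 \<in> closure (range A)"
    using bounded_clinear_zero[OF A] closure_subset by (metis rangeI subsetD)
  have add: "u + v \<in> closure (range A)" if uv: "u \<in> closure (range A)" "v \<in> closure (range A)" for u v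
  proof -
    from uv lim obtain f g where "\<And>n. f n \<in> range A" "f \<longlonglongrightarrow> u" "\<And>n. g n \<in> range A" "g \<longlonglongrightarrow> v"
      by metis
    then have "(\<lambda>n. f n + g n) \<longlonglongrightarrow> u + v" and "\<forall>n. f n + g n \<in> range A"
      by (auto intro!: tendsto_add) (metis bounded_clinear_add[OF A] rangeE rangeI)
    then show ?thesis
      unfolding closure_sequential by (intro exI[of _ "\<lambda>n. f n + g n"] conjI)
  qed
  have scale: "c *\<^sub>C u \<in> closure (range A)" if u: "u \<in> closure (range A)" for c u
  proof -
    from u lim obtain f where f: "\<And>n. f n \<in> range A" "f \<longlonglongrightarrow> u"
      by metis
    have "bounded_linear (\<lambda>x::'a. c *\<^sub>C x)"
      by (rule bounded_linear_intro[where K = "cmod c"])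
        (simp_all add: scaleC_add_right scaleR_scaleC scaleC_scaleC mult.commute norm_scaleC)
    with f(2) have "(\<lambda>n. c *\<^sub>C f n) \<longlonglongrightarrow> c *\<^sub>C u"
      using bounded_linear.tendsto by blast
    moreover have "\<forall>n. c *\<^sub>C f n \<in> range A"
      using f(1) by (metis bounded_clinear_scaleC[OF A] rangeE rangeI)
    ultimately show ?thesis
      unfolding closure_sequential by (intro exI[of _ "\<lambda>n. c *\<^sub>C f n"] conjI)
  qed
  obtain p where p: "p \<in> closure (range A)" "x - p \<in> corthogonal_comp (closure (range A))"
    by (rule orthogonal_projection_exists[OF closed_closure zero add scale])
  have "A (x - p) = 0"
    using p(2) closure_subset[of "range A"]
    by (auto simp: kernel_iff_corthogonal_range corthogonal_comp_def)
  moreover have "p \<in> corthogonal_comp {z. A z = 0}"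
    using perp_closure p(1) by (auto simp: corthogonal_comp_def)
  ultimately show ?thesis
    using that[of p "x - p"] p(1) by simp
qed

section \<open>The Moore-Penrose inverse on the range of \<open>A\<close>, and the
  \<open>A\<close>-adjoint\<close>

lemma mp_inverse_range: "A (mp_inverse A (A w)) = A w"
proof -
  note A = positive_op_bounded_clinear[OF pos]
  define P where "P = (\<lambda>x. x \<in> corthogonal_comp {z. A z = 0} \<and> A w - A x \<in> corthogonal_comp (range A))"
  \<comment> \<open>The residual \<open>A w - A x\<close> lies in the range of \<open>A\<close> and
    is orthogonal to it.\<close>
  have P: "A x = A w" if "P x" for x
  proof -
    have "A w - A x = A (w - x)"
      by (simp add: bounded_clinear_diff[OF A])
    then have "cinner (A w - A x) (A w - A x) = 0"
      using that by (auto simp: P_def corthogonal_comp_def)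
    then show ?thesis by simp
  qed
  obtain p k where pk: "w = p + k" "A k = 0" "p \<in> corthogonal_comp {z. A z = 0}"
    by (rule range_kernel_decomposition[of w])
  have "\<exists>!x. P x"
  proof (rule ex1I)
    show "P p"
      using pk by (simp add: P_def bounded_clinear_add[OF A] corthogonal_comp_def)
    fix x assume x: "P x"
    \<comment> \<open>The difference of two candidates is in the kernel and orthogonal to the
      kernel, hence zero.\<close>
    have "A (x - p) = 0"
      using P[OF x] P[OF \<open>P p\<close>] by (simp add: bounded_clinear_diff[OF A])
    then have "cinner (x - p) (x - p) = 0"
      using x pk(3) unfolding P_def corthogonal_comp_def
      by (subst cinner_diff_left) simp
    then show "x = p" by simp
  qed
  then have "P (THE x. P x)"
    by (rule theI')
  then show ?thesis
    using P unfolding mp_inverse_def P_def by blast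
qed

text \<open>Any solution \<open>S\<close> of the defining equation places
  \<open>cadjoint T (A x)\<close> in the range of \<open>A\<close>, where
  \<open>mp_inverse A\<close> is a true right inverse.\<close>

lemma A_sharp:
  assumes "T \<in> adjointable_ops A"
  shows "A (sharp A T x) = cadjoint T (A x)"
proof -
  obtain S where "A \<circ> S = cadjoint T \<circ> A"
    using assms by (auto simp: adjointable_ops_def)
  then have "cadjoint T (A x) = A (S x)"
    by (metis comp_apply)
  then show ?thesis
    by (simp add: sharp_def mp_inverse_range)
qed

lemma semi_inner_sharp_left:
  assumes "T \<in> adjointable_ops A"
  shows "semi_inner A (sharp A T x) y = semi_inner A x (T y)"
proof -
  have "bounded_clinear T"
    using assms by (simp add: adjointable_ops_def)
  then have "cinner (T y) (A x) = cinner y (cadjoint T (A x))"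
    by (rule cinner_cadjoint)
  then show ?thesis
    unfolding semi_inner_def A_sharp[OF assms] by (metis cinner_commute)
qed

lemma semi_inner_sharp_right:
  assumes "T \<in> adjointable_ops A"
  shows "semi_inner A x (sharp A T y) = semi_inner A (T x) y"
  using semi_inner_sharp_left[OF assms] semi_inner_commute[OF pos] by metis

section \<open>Boundedness with respect to the seminorm of \<open>A\<close>\<close>

lemma semi_norm_le_norm: "\<exists>c\<ge>0. \<forall>x. semi_norm A x \<le> c * norm x"
proof -
  obtain K where K: "\<And>x. norm (A x) \<le> norm x * K" "K \<ge> 0"
    using positive_op_bounded_clinear[OF pos] bounded_linear.nonneg_bounded
    unfolding bounded_clinear_def by blast
  have "semi_norm A x \<le> sqrt K * norm x" for x
  proof (rule power2_le_imp_le)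
    have "(semi_norm A x)\<^sup>2 \<le> cmod (cinner (A x) x)"
      unfolding semi_norm_sq[OF pos] semi_inner_def by (rule complex_Re_le_cmod)
    also have "\<dots> \<le> norm x * K * norm x"
      using Cauchy_Schwarz_cinner[of "A x" x] mult_right_mono[OF K(1)[of x] norm_ge_zero[of x]]
      by linarith
    also have "\<dots> = (sqrt K * norm x)\<^sup>2"
      using K(2) by (simp add: power_mult_distrib) (simp add: power2_eq_square)
    finally show "(semi_norm A x)\<^sup>2 \<le> (sqrt K * norm x)\<^sup>2" .
  qed (simp add: K)
  then show ?thesis
    using K(2) by (intro exI[of _ "sqrt K"]) simp
qed

text \<open>The sequence \<open>\<parallel>R\<^sup>n x\<parallel>\<^sub>A\<close> is log-convex, and it grows at most like the \<open>n\<close>-th power of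
  the operator norm of \<open>R\<close>; hence its first ratio is bounded by that norm.\<close>

lemma semi_bounded_of_semi_symmetric:
  assumes R: "bounded_clinear R"
    and sym: "\<And>x y. semi_inner A (R x) y = semi_inner A x (R y)"
  shows "\<exists>c\<ge>0. \<forall>x. semi_norm A (R x) \<le> c * semi_norm A x"
proof -
  obtain K where K: "\<And>x. norm (R x) \<le> norm x * K" "K > 0"
    using R bounded_linear.pos_bounded unfolding bounded_clinear_def by blast
  obtain c where c: "c \<ge> 0" "\<And>x. semi_norm A x \<le> c * norm x"
    using semi_norm_le_norm by blast
  have "semi_norm A (R x) \<le> K * semi_norm A x" for x
  proof (rule ccontr)
    assume asm: "\<not> semi_norm A (R x) \<le> K * semi_norm A x"
    define a where "a n = semi_norm A ((R ^^ n) x)" for n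
    have a0: "a n \<ge> 0" for n
      by (simp add: a_def semi_norm_nonneg[OF pos])
    have convex: "(a (Suc n))\<^sup>2 \<le> a n * a (Suc (Suc n))" for n
    proof -
      \<comment> \<open>Symmetry moves one factor \<open>R\<close> across the form, so
        Cauchy-Schwarz compares the terms \<open>n\<close> and \<open>n + 2\<close>.\<close>
      have "(a (Suc n))\<^sup>2 = Re (semi_inner A ((R ^^ n) x) (R (R ((R ^^ n) x))))"
        by (simp add: a_def semi_norm_sq[OF pos] sym)
      also have "\<dots> \<le> a n * a (Suc (Suc n))"
        using Cauchy_Schwarz_semi_inner[OF pos] complex_Re_le_cmod order_trans
        by (fastforce simp: a_def)
      finally show ?thesis .
    qed
    have power: "norm ((R ^^ n) x) \<le> K ^ n * norm x" for n
    proof (induction n)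
      case (Suc n)
      then show ?case
        using K(1)[of "(R ^^ n) x"] mult_left_mono[OF Suc less_imp_le[OF K(2)]]
        by (simp add: mult_ac)
    qed simp
    have growth: "a n \<le> c * norm x * K ^ n" for n
      using order_trans[OF c(2) mult_left_mono[OF power c(1)]] by (simp add: a_def mult_ac)
    have gt: "K * a 0 < a 1"
      using asm by (simp add: a_def)
    have "a 0 \<noteq> 0"
    proof
      assume "a 0 = 0"
      then show False
        using convex[of 0] gt by simp
    qed
    then have pos0: "a 0 > 0"
      using a0[of 0] by simp
    \<comment> \<open>By log-convexity no later ratio falls below this first one, so
      \<open>a\<close> grows at least like \<open>q ^ n\<close> and outruns the bound
      \<open>growth\<close>.\<close>
    define q where "q = a 1 / a 0"
    have q: "q > K"
      using gt pos0 by (simp add: q_def field_simps)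
    have step: "a n > 0 \<and> a (Suc n) \<ge> q * a n" for n
    proof (induction n)
      case 0
      then show ?case using pos0 by (simp add: q_def)
    next
      case (Suc n)
      have "0 < q * a n"
        using Suc q K(2) by (intro mult_pos_pos) auto
      then have 1: "a (Suc n) > 0"
        using Suc by linarith
      have "(q * a n) * a (Suc n) \<le> (a (Suc n))\<^sup>2"
        using Suc 1 by (simp add: power2_eq_square)
      also have "\<dots> \<le> a n * a (Suc (Suc n))"
        by (rule convex)
      finally have "a n * (q * a (Suc n)) \<le> a n * a (Suc (Suc n))"
        by (simp add: mult_ac)
      then have "q * a (Suc n) \<le> a (Suc (Suc n))"
        using Suc by simp
      with 1 show ?case by simp
    qed
    have lower: "q ^ n * a 0 \<le> a n" for n
    proof (induction n)
      case (Suc n)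
      have "q * (q ^ n * a 0) \<le> q * a n"
        using Suc q K(2) by (intro mult_left_mono) auto
      then show ?case
        using step[of n] by (simp add: mult_ac)
    qed simp
    have "1 < q / K"
      using q K(2) by simp
    then obtain n where n: "c * norm x / a 0 < (q / K) ^ n"
      using real_arch_pow by blast
    then have "c * norm x * K ^ n < q ^ n * a 0"
      using pos0 K(2) by (simp add: field_simps)
    then show False
      using lower[of n] growth[of n] by linarith
  qed
  then show ?thesis
    using K(2) by (intro exI[of _ K]) simp
qed

text \<open>The squared seminorm of \<open>T x\<close> is the form of \<open>S \<circ> T\<close> at
  \<open>x\<close>, and \<open>S \<circ> T\<close> is symmetric for the semi-inner product. The
  witness \<open>S\<close> replaces \<open>sharp A T\<close> because it comes with
  \<open>bounded_clinear\<close>.\<close>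

lemma adjointable_semi_bounded:
  assumes T: "T \<in> adjointable_ops A"
  obtains c where "c \<ge> 0" and "\<And>x. semi_norm A (T x) \<le> c * semi_norm A x"
proof -
  obtain S where bT: "bounded_clinear T" and S: "bounded_clinear S" "A \<circ> S = cadjoint T \<circ> A"
    using T by (auto simp: adjointable_ops_def)
  have AS: "A (S x) = cadjoint T (A x)" for x
    using S(2) by (metis comp_apply)
  have left: "semi_inner A (S x) y = semi_inner A x (T y)" for x y
    using semi_inner_sharp_left[OF T, of x y] by (simp add: semi_inner_def AS A_sharp[OF T])
  then have right: "semi_inner A x (S y) = semi_inner A (T x) y" for x y
    using semi_inner_commute[OF pos] by metis
  have "bounded_clinear (S \<circ> T)"
    by (rule bounded_clinear_compose[OF S(1) bT])
  then obtain c where c: "c \<ge> 0" "\<And>x. semi_norm A (S (T x)) \<le> c * semi_norm A x"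
    using semi_bounded_of_semi_symmetric[of "S \<circ> T"] left right by auto
  have "semi_norm A (T x) \<le> sqrt c * semi_norm A x" for x
  proof (rule power2_le_imp_le)
    have "(semi_norm A (T x))\<^sup>2 \<le> cmod (semi_inner A (S (T x)) x)"
      unfolding semi_norm_sq[OF pos] left by (rule complex_Re_le_cmod)
    also have "\<dots> \<le> c * semi_norm A x * semi_norm A x"
      using Cauchy_Schwarz_semi_inner[OF pos, of "S (T x)" x]
        mult_right_mono[OF c(2)[of x] semi_norm_nonneg[OF pos, of x]] by linarith
    also have "\<dots> = (sqrt c * semi_norm A x)\<^sup>2"
      using c(1) by (simp add: power_mult_distrib) (simp add: power2_eq_square)
    finally show "(semi_norm A (T x))\<^sup>2 \<le> (sqrt c * semi_norm A x)\<^sup>2" .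
  qed (simp add: c semi_norm_nonneg[OF pos])
  with that[of "sqrt c"] c(1) show ?thesis by simp
qed

text \<open>The constant of \<open>T\<close> carries over: the squared seminorm of
  \<open>sharp A T x\<close> is the form of \<open>x\<close> with \<open>T (sharp A T x)\<close>,
  and one factor cancels.\<close>

lemma sharp_semi_bounded:
  assumes T: "T \<in> adjointable_ops A"
  obtains c where "c \<ge> 0" and "\<And>x. semi_norm A (sharp A T x) \<le> c * semi_norm A x"
proof -
  obtain c where c: "c \<ge> 0" "\<And>x. semi_norm A (T x) \<le> c * semi_norm A x"
    using adjointable_semi_bounded[OF T] by blast
  have "semi_norm A (sharp A T x) \<le> c * semi_norm A x" for x
  proof (cases "semi_norm A (sharp A T x) = 0")
    case False
    let ?s = "semi_norm A (sharp A T x)"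
    have "?s\<^sup>2 \<le> cmod (semi_inner A x (T (sharp A T x)))"
      unfolding semi_norm_sq[OF pos] semi_inner_sharp_left[OF T] by (rule complex_Re_le_cmod)
    also have "\<dots> \<le> semi_norm A x * (c * ?s)"
      using Cauchy_Schwarz_semi_inner[OF pos, of x "T (sharp A T x)"]
        mult_left_mono[OF c(2)[of "sharp A T x"] semi_norm_nonneg[OF pos, of x]] by linarith
    finally have "?s * ?s \<le> (c * semi_norm A x) * ?s"
      by (simp add: power2_eq_square mult_ac)
    moreover have "?s > 0"
      using False semi_norm_nonneg[OF pos, of "sharp A T x"] by linarith
    ultimately show ?thesis
      by simp
  qed (simp add: c semi_norm_nonneg[OF pos])
  with that c(1) show ?thesis by blast
qed

section \<open>From the suprema to estimates for individual vectors\<close>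

lemma op_seminorm_bounds:
  assumes "\<And>x. semi_norm A (T x) \<le> c * semi_norm A x" and "c \<ge> 0"
  shows "0 \<le> op_seminorm A T"
    and "x \<in> closure (range A) \<Longrightarrow> semi_norm A (T x) \<le> op_seminorm A T * semi_norm A x"
proof -
  let ?S = "insert 0 {semi_norm A (T x) / semi_norm A x | x. x \<in> closure (range A) \<and> x \<noteq> 0}"
  have bdd: "bdd_above ?S"
  proof (rule bdd_aboveI[of _ c])
    fix r assume "r \<in> ?S"
    then consider "r = 0" | x where "r = semi_norm A (T x) / semi_norm A x" by blast
    then show "r \<le> c"
    proof cases
      \<comment> \<open>Where the seminorm of \<open>x\<close> vanishes, the quotient is 0 by
        convention, still at most \<open>c\<close>.\<close>
      case 2
      then show ?thesis
        using assms(1)[of x] assms(2) semi_norm_nonneg[OF pos, of x]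
        by (cases "semi_norm A x = 0") (auto simp: pos_divide_le_eq)
    qed (use assms in simp)
  qed
  then show "0 \<le> op_seminorm A T"
    unfolding op_seminorm_def by (intro cSup_upper) auto
  assume x: "x \<in> closure (range A)"
  show "semi_norm A (T x) \<le> op_seminorm A T * semi_norm A x"
  proof (cases "semi_norm A x = 0")
    case True
    then show ?thesis using assms(1)[of x] by simp
  next
    case False
    then have "x \<noteq> 0"
      using semi_norm_eq_0_if_kernel bounded_clinear_zero[OF positive_op_bounded_clinear[OF pos]] by blast
    then have "semi_norm A (T x) / semi_norm A x \<le> op_seminorm A T"
      unfolding op_seminorm_def using x bdd by (intro cSup_upper) auto
    then show ?thesis
      using False semi_norm_nonneg[OF pos, of x] by (simp add: pos_divide_le_eq)
  qed
qed

text \<open>Rescaling to a unit vector reduces the estimate to the supremum, which is finite by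
  \<open>bounded\<close>. If the seminorm of \<open>x\<close> is zero, no rescaling is possible and
  Cauchy-Schwarz makes the left side vanish.\<close>

lemma num_radius_bounds:
  assumes bounded: "\<And>x. semi_norm A (T x) \<le> c * semi_norm A x" and "c \<ge> 0"
    and T: "bounded_clinear T"
  shows "0 \<le> num_radius A T"
    and "cmod (semi_inner A (T x) x) \<le> num_radius A T * (semi_norm A x)\<^sup>2"
proof -
  let ?S = "insert 0 {cmod (semi_inner A (T x) x) | x. semi_norm A x = 1}"
  have bdd: "bdd_above ?S"
  proof (rule bdd_aboveI[of _ c])
    fix r assume "r \<in> ?S"
    then consider "r = 0" | x where "r = cmod (semi_inner A (T x) x)" "semi_norm A x = 1" by blast
    then show "r \<le> c"
    proof cases
      case 2
      then show ?thesis
        using Cauchy_Schwarz_semi_inner[OF pos, of "T x" x] bounded[of x] by simp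
    qed (use assms in simp)
  qed
  then show nonneg: "0 \<le> num_radius A T"
    unfolding num_radius_def by (intro cSup_upper) auto
  show "cmod (semi_inner A (T x) x) \<le> num_radius A T * (semi_norm A x)\<^sup>2"
  proof (cases "semi_norm A x = 0")
    case True
    then show ?thesis using Cauchy_Schwarz_semi_inner[OF pos, of "T x" x] by simp
  next
    case False
    define s where "s = semi_norm A x"
    have s: "s > 0"
      using False semi_norm_nonneg[OF pos, of x] by (simp add: s_def)
    define e where "e = complex_of_real (1 / s) *\<^sub>C x"
    have "semi_norm A e = 1"
      using s by (simp add: e_def semi_norm_scaleC[OF pos] norm_divide flip: s_def)
    then have "cmod (semi_inner A (T e) e) \<le> num_radius A T"
      unfolding num_radius_def using bdd by (intro cSup_upper) auto
    moreover have "cmod (semi_inner A (T e) e) = cmod (semi_inner A (T x) x) / s\<^sup>2"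
      using s by (simp add: e_def bounded_clinear_scaleC[OF T] semi_inner_scaleC_left[OF pos]
          semi_inner_scaleC_right[OF pos] norm_mult norm_divide power2_eq_square)
    ultimately show ?thesis
      using s by (simp add: pos_divide_le_eq flip: s_def)
  qed
qed

text \<open>Only vectors in the closed range of \<open>A\<close> enter the operator seminorm; the kernel component
  of \<open>u\<close> does not contribute to the left-hand side.\<close>

lemma quadratic_form_le_op_seminorm:
  assumes X: "X \<in> adjointable_ops A" and Y: "Y \<in> adjointable_ops A"
  shows "0 \<le> op_seminorm A (\<lambda>x. sharp A X (X x) + Y (sharp A Y x))"
    and "(semi_norm A (X u))\<^sup>2 + (semi_norm A (sharp A Y u))\<^sup>2
      \<le> op_seminorm A (\<lambda>x. sharp A X (X x) + Y (sharp A Y x)) * (semi_norm A u)\<^sup>2"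
proof -
  let ?P = "\<lambda>x. sharp A X (X x) + Y (sharp A Y x)"
  obtain c where c: "c \<ge> 0" "\<And>x. semi_norm A (X x) \<le> c * semi_norm A x"
    using adjointable_semi_bounded[OF X] by blast
  obtain c' where c': "c' \<ge> 0" "\<And>x. semi_norm A (sharp A X x) \<le> c' * semi_norm A x"
    using sharp_semi_bounded[OF X] by blast
  obtain d where d: "d \<ge> 0" "\<And>x. semi_norm A (Y x) \<le> d * semi_norm A x"
    using adjointable_semi_bounded[OF Y] by blast
  obtain d' where d': "d' \<ge> 0" "\<And>x. semi_norm A (sharp A Y x) \<le> d' * semi_norm A x"
    using sharp_semi_bounded[OF Y] by blast
  have P: "semi_norm A (?P x) \<le> (c' * c + d * d') * semi_norm A x" for x
  proof -
    have "semi_norm A (sharp A X (X x)) \<le> c' * (c * semi_norm A x)"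
      using c'(2)[of "X x"] mult_left_mono[OF c(2)[of x] c'(1)] by linarith
    moreover have "semi_norm A (Y (sharp A Y x)) \<le> d * (d' * semi_norm A x)"
      using d(2)[of "sharp A Y x"] mult_left_mono[OF d'(2)[of x] d(1)] by linarith
    ultimately show ?thesis
      using semi_norm_triangle[OF pos, of "sharp A X (X x)" "Y (sharp A Y x)"]
      by (simp add: distrib_right mult.assoc)
  qed
  have P0: "0 \<le> c' * c + d * d'"
    using c(1) c'(1) d(1) d'(1) by simp
  show "0 \<le> op_seminorm A ?P"
    using P P0 by (rule op_seminorm_bounds(1))
  obtain p k where u: "u = p + k" and p: "p \<in> closure (range A)" and k: "A k = 0"
    by (rule range_kernel_decomposition[of u])
  have k0: "semi_norm A k = 0"
    by (rule semi_norm_eq_0_if_kernel[OF k])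
  have Au: "A u = A p"
    by (simp add: u k bounded_clinear_add[OF positive_op_bounded_clinear[OF pos]])
  have "semi_norm A (X u) \<le> semi_norm A (X p)"
  proof -
    \<comment> \<open>Boundedness of \<open>X\<close> for the seminorm keeps \<open>X k\<close> at
      seminorm zero.\<close>
    have "X u = X p + X k"
      using X by (simp add: u adjointable_ops_def bounded_clinear_add)
    then show ?thesis
      using semi_norm_triangle[OF pos, of "X p" "X k"] c(2)[of k] k0 by simp
  qed
  then have "(semi_norm A (X u))\<^sup>2 \<le> (semi_norm A (X p))\<^sup>2"
    by (simp add: power_mono semi_norm_nonneg[OF pos])
  also have "\<dots> = Re (semi_inner A (sharp A X (X p)) p)"
    by (simp add: semi_norm_sq[OF pos] semi_inner_sharp_left[OF X])
  finally have 1: "(semi_norm A (X u))\<^sup>2 \<le> Re (semi_inner A (sharp A X (X p)) p)" .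
  \<comment> \<open>\<open>sharp A Y\<close> sees its argument only through \<open>A\<close>, and
    \<open>A u = A p\<close>.\<close>
  have "(semi_norm A (sharp A Y u))\<^sup>2 = (semi_norm A (sharp A Y p))\<^sup>2"
    by (simp add: sharp_def Au)
  also have "\<dots> = Re (semi_inner A (Y (sharp A Y p)) p)"
    by (simp add: semi_norm_sq[OF pos] semi_inner_sharp_right[OF Y])
  finally have "(semi_norm A (X u))\<^sup>2 + (semi_norm A (sharp A Y u))\<^sup>2 \<le> Re (semi_inner A (?P p) p)"
    using 1 by (simp add: semi_inner_add_left[OF pos])
  also have "\<dots> \<le> semi_norm A (?P p) * semi_norm A p"
    using Cauchy_Schwarz_semi_inner[OF pos] complex_Re_le_cmod order_trans by blast
  also have "\<dots> \<le> op_seminorm A ?P * semi_norm A p * semi_norm A p"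
    using op_seminorm_bounds(2)[where T = ?P, OF P P0 p] semi_norm_nonneg[OF pos]
    by (intro mult_right_mono) auto
  also have "semi_norm A p = semi_norm A u"
    unfolding semi_norm_def semi_inner_def Au
    using positive_op_selfadjoint[of p k] k by (simp add: u cinner_add_right)
  finally show "(semi_norm A (X u))\<^sup>2 + (semi_norm A (sharp A Y u))\<^sup>2
      \<le> op_seminorm A ?P * (semi_norm A u)\<^sup>2"
    by (simp add: power2_eq_square mult.assoc)
qed

text \<open>The parameter \<open>\<beta>\<close> interpolates between the Buzano bound and the Cauchy-Schwarz bound
  for \<open>\<langle>Tz, T'z\<rangle>\<^sub>A\<close>.\<close>

lemma semi_inner_pow4_le:
  assumes adj: "\<And>x y. semi_inner A (T x) y = semi_inner A x (T' y)"
    and z: "semi_norm A z = 1" and "\<alpha> \<noteq> 0" and \<beta>: "\<beta> \<ge> (0::real)"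
  shows "cmod (semi_inner A (T z) z) ^ 4
    \<le> (2 * (\<beta> + 1) * max 1 ((cmod (\<alpha> - 1))\<^sup>2) + 2 * \<beta>) / ((cmod \<alpha>)\<^sup>2 * (\<beta> + 1)) / 4
        * ((semi_norm A (T z))\<^sup>2 + (semi_norm A (T' z))\<^sup>2)\<^sup>2
      + 2 / ((cmod \<alpha>)\<^sup>2 * (\<beta> + 1)) * (cmod (semi_inner A (T (T z)) z))\<^sup>2"
proof -
  define m where "m = max 1 (cmod (\<alpha> - 1))"
  define a where "a = semi_norm A (T z)"
  define b where "b = semi_norm A (T' z)"
  define w where "w = cmod (semi_inner A (T (T z)) z)"
  define v where "v = cmod (semi_inner A (T z) z)"
  have m2: "max 1 ((cmod (\<alpha> - 1))\<^sup>2) = m\<^sup>2"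
    using power_le_one[of "cmod (\<alpha> - 1)" 2] one_le_power[of "cmod (\<alpha> - 1)" 2]
    by (cases "cmod (\<alpha> - 1) \<le> 1") (simp_all add: m_def max_absorb1 max_absorb2)
  \<comment> \<open>Buzano with \<open>e = z\<close>, applied to \<open>T z\<close> and
    \<open>T' z\<close>; \<open>adj\<close> turns the second factor into \<open>v\<close> and the
    mixed product into \<open>w\<close>.\<close>
  have v2: "v\<^sup>2 \<le> (m * (a * b) + w) / cmod \<alpha>"
    using Buzano_semi_inner[OF pos z \<open>\<alpha> \<noteq> 0\<close>, of "T z" "T' z"]
    by (simp add: m_def a_def b_def w_def v_def power2_eq_square flip: adj)
  have ab: "w \<le> a * b"
    using Cauchy_Schwarz_semi_inner[OF pos, of "T z" "T' z"]
    by (simp add: a_def b_def w_def flip: adj)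
  have split: "(M * (s / 4) + 2 * t) / l / k = M / (k * l) / 4 * s + 2 / (k * l) * t" for M s t l k :: real
    by (simp add: add_divide_distrib mult_ac)
  have w0: "0 \<le> w" by (simp add: w_def)
  have "v ^ 4 = (v\<^sup>2)\<^sup>2" by simp
  also have "\<dots> \<le> ((m * (a * b) + w) / cmod \<alpha>)\<^sup>2"
    using v2 by (intro power_mono) auto
  also have "\<dots> \<le> (2 * m\<^sup>2 * (a * b)\<^sup>2 + 2 * w\<^sup>2) / (cmod \<alpha>)\<^sup>2"
    unfolding power_divide
  proof (rule divide_right_mono)
    have "0 \<le> (m * (a * b) - w)\<^sup>2" by simp
    then show "(m * (a * b) + w)\<^sup>2 \<le> 2 * m\<^sup>2 * (a * b)\<^sup>2 + 2 * w\<^sup>2"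
      by (simp add: power2_sum power2_diff power_mult_distrib mult_ac)
  qed simp
  also have "\<dots> \<le> ((2 * (\<beta> + 1) * m\<^sup>2 + 2 * \<beta>) * (a * b)\<^sup>2 + 2 * w\<^sup>2) / (\<beta> + 1) / (cmod \<alpha>)\<^sup>2"
  proof (rule divide_right_mono)
    \<comment> \<open>Over the denominator \<open>\<beta> + 1\<close> the term
      \<open>2 * w\<^sup>2\<close> has numerator
      \<open>2 * w\<^sup>2 + 2 * \<beta> * w\<^sup>2\<close>; only the second summand is traded for
      \<open>(a * b)\<^sup>2\<close>.\<close>
    have "\<beta> * w\<^sup>2 \<le> \<beta> * (a * b)\<^sup>2"
      using ab w0 \<beta> by (intro mult_left_mono power_mono)
    then show "2 * m\<^sup>2 * (a * b)\<^sup>2 + 2 * w\<^sup>2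
        \<le> ((2 * (\<beta> + 1) * m\<^sup>2 + 2 * \<beta>) * (a * b)\<^sup>2 + 2 * w\<^sup>2) / (\<beta> + 1)"
      using \<beta> by (simp add: pos_le_divide_eq algebra_simps)
  qed simp
  also have "\<dots> \<le> ((2 * (\<beta> + 1) * m\<^sup>2 + 2 * \<beta>) * ((a\<^sup>2 + b\<^sup>2)\<^sup>2 / 4) + 2 * w\<^sup>2) / (\<beta> + 1) / (cmod \<alpha>)\<^sup>2"
  proof (intro divide_right_mono add_right_mono mult_left_mono)
    have "0 \<le> (a\<^sup>2 - b\<^sup>2)\<^sup>2" by simp
    then show "(a * b)\<^sup>2 \<le> (a\<^sup>2 + b\<^sup>2)\<^sup>2 / 4"
      by (simp add: power2_sum power2_diff power_mult_distrib)
  qed (use \<beta> in auto)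
  also have "\<dots> = (2 * (\<beta> + 1) * m\<^sup>2 + 2 * \<beta>) / ((cmod \<alpha>)\<^sup>2 * (\<beta> + 1)) / 4 * (a\<^sup>2 + b\<^sup>2)\<^sup>2
      + 2 / ((cmod \<alpha>)\<^sup>2 * (\<beta> + 1)) * w\<^sup>2"
    by (rule split)
  finally show ?thesis
    by (simp only: m2 a_def b_def v_def w_def)
qed

end

section \<open>Block operators on the product space\<close>

lemma bounded_clinear_block_diag:
  assumes P: "bounded_clinear P" and S: "bounded_clinear S"
  shows "bounded_clinear (block_op P (\<lambda>_. 0) (\<lambda>_. 0) S)"
proof -
  have "block_op P (\<lambda>_. 0) (\<lambda>_. 0) S = (\<lambda>z. (P (fst z), S (snd z)))"
    by (auto simp: block_op_def)
  moreover have "bounded_linear (\<lambda>z. (P (fst z), S (snd z)))"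
    using P S unfolding bounded_clinear_def
    by (intro bounded_linear_Pair bounded_linear_compose[OF _ bounded_linear_fst]
        bounded_linear_compose[OF _ bounded_linear_snd]) auto
  ultimately show ?thesis
    by (auto simp: bounded_clinear_def scaleC_prod_def bounded_clinear_scaleC[OF P]
        bounded_clinear_scaleC[OF S])
qed

lemma semi_inner_block_diag:
  "semi_inner (block_op A (\<lambda>_. 0) (\<lambda>_. 0) A) z w
    = semi_inner A (fst z) (fst w) + semi_inner A (snd z) (snd w)"
  by (cases z; cases w) (simp add: semi_inner_def block_op_def cinner_prod_def)

lemma positive_op_block_diag:
  assumes "positive_op A"
  shows "positive_op (block_op A (\<lambda>_. 0) (\<lambda>_. 0) A)"
  unfolding positive_op_def
proof (intro conjI allI)
  show "bounded_clinear (block_op A (\<lambda>_. 0) (\<lambda>_. 0) A)"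
    using assms by (intro bounded_clinear_block_diag) (simp_all add: positive_op_def)
  show "cinner (block_op A (\<lambda>_. 0) (\<lambda>_. 0) A z) z \<in> \<real>\<^sub>\<ge>\<^sub>0" for z
    using semi_inner_block_diag[of A z z] semi_inner_self_nonneg[OF assms]
    by (simp add: semi_inner_def nonneg_Reals_add_I)
qed

theorem theorem2p18:
  fixes A X Y :: "'a::chilbert_space \<Rightarrow> 'a"
    and \<alpha> :: complex and \<beta> \<delta>\<^sub>1 \<delta>\<^sub>2 :: real
  assumes "positive_op A"
    and "X \<in> adjointable_ops A" and "Y \<in> adjointable_ops A"
    and "\<alpha> \<noteq> 0" and "\<beta> \<ge> 0"
    and "\<delta>\<^sub>1 = (2 * (\<beta> + 1) * max 1 ((cmod (\<alpha> - 1))\<^sup>2) + 2 * \<beta>) / ((cmod \<alpha>)\<^sup>2 * (\<beta> + 1))"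
    and "\<delta>\<^sub>2 = 2 / ((cmod \<alpha>)\<^sup>2 * (\<beta> + 1))"
  shows "(num_radius (block_op A (\<lambda>_. 0) (\<lambda>_. 0) A) (block_op (\<lambda>_. 0) X Y (\<lambda>_. 0))) ^ 4
    \<le> \<delta>\<^sub>1 / 4 * max ((op_seminorm A (\<lambda>x. sharp A X (X x) + Y (sharp A Y x)))\<^sup>2)
                   ((op_seminorm A (\<lambda>x. X (sharp A X x) + sharp A Y (Y x)))\<^sup>2)
      + \<delta>\<^sub>2 * max ((num_radius A (X \<circ> Y))\<^sup>2) ((num_radius A (Y \<circ> X))\<^sup>2)"
proof -
  note pos = assms(1) and X = assms(2) and Y = assms(3)
  let ?A = "block_op A (\<lambda>_. 0) (\<lambda>_. 0) A"
  let ?T = "block_op (\<lambda>_. 0) X Y (\<lambda>_. 0)"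
  let ?T' = "block_op (\<lambda>_. 0) (sharp A Y) (sharp A X) (\<lambda>_. 0)"
  define N\<^sub>1 where "N\<^sub>1 = op_seminorm A (\<lambda>x. sharp A X (X x) + Y (sharp A Y x))"
  define N\<^sub>2 where "N\<^sub>2 = op_seminorm A (\<lambda>x. X (sharp A X x) + sharp A Y (Y x))"
  define W\<^sub>1 where "W\<^sub>1 = num_radius A (X \<circ> Y)"
  define W\<^sub>2 where "W\<^sub>2 = num_radius A (Y \<circ> X)"
  note pos' = positive_op_block_diag[OF pos]
  have bX: "bounded_clinear X" and bY: "bounded_clinear Y"
    using X Y by (simp_all add: adjointable_ops_def)
  \<comment> \<open>With the summands swapped, the second seminorm is the first with
    \<open>X\<close> and \<open>Y\<close> exchanged, so one quadratic form estimate serves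
    both.\<close>
  have N2: "N\<^sub>2 = op_seminorm A (\<lambda>x. sharp A Y (Y x) + X (sharp A X x))"
    by (simp add: N\<^sub>2_def add.commute)
  note q1 = quadratic_form_le_op_seminorm[OF pos X Y, folded N\<^sub>1_def]
  note q2 = quadratic_form_le_op_seminorm[OF pos Y X, folded N2]
  obtain c where c: "c \<ge> 0" "\<And>x. semi_norm A (X x) \<le> c * semi_norm A x"
    using adjointable_semi_bounded[OF pos X] by blast
  obtain d where d: "d \<ge> 0" "\<And>x. semi_norm A (Y x) \<le> d * semi_norm A x"
    using adjointable_semi_bounded[OF pos Y] by blast
  have XY: "semi_norm A ((X \<circ> Y) x) \<le> c * d * semi_norm A x"
    and YX: "semi_norm A ((Y \<circ> X) x) \<le> c * d * semi_norm A x" for x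
    using c(2)[of "Y x"] mult_left_mono[OF d(2)[of x] c(1)]
      d(2)[of "X x"] mult_left_mono[OF c(2)[of x] d(1)] by (auto simp: mult_ac)
  have cd: "0 \<le> c * d"
    using c(1) d(1) by simp
  note w1 = num_radius_bounds[OF pos XY cd bounded_clinear_compose[OF bX bY], folded W\<^sub>1_def]
  note w2 = num_radius_bounds[OF pos YX cd bounded_clinear_compose[OF bY bX], folded W\<^sub>2_def]
  define N where "N = max N\<^sub>1 N\<^sub>2"
  define W where "W = max W\<^sub>1 W\<^sub>2"
  have N: "max (N\<^sub>1\<^sup>2) (N\<^sub>2\<^sup>2) = N\<^sup>2" and W: "max (W\<^sub>1\<^sup>2) (W\<^sub>2\<^sup>2) = W\<^sup>2"
    using q1(1) q2(1) w1(1) w2(1) unfolding N_def W_def max_def by simp_all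
  have \<delta>: "0 \<le> \<delta>\<^sub>1" "0 \<le> \<delta>\<^sub>2"
    using assms(5) by (auto simp: assms(6,7) intro!: divide_nonneg_nonneg add_nonneg_nonneg mult_nonneg_nonneg)
  have T: "?T z = (X (snd z), Y (fst z))" "?T' z = (sharp A Y (snd z), sharp A X (fst z))" for z
    by (simp_all add: block_op_def case_prod_beta)
  have pointwise: "cmod (semi_inner ?A (?T z) z) ^ 4 \<le> \<delta>\<^sub>1 / 4 * N\<^sup>2 + \<delta>\<^sub>2 * W\<^sup>2" if z: "semi_norm ?A z = 1" for z
  proof -
    obtain u v where uv: "z = (u, v)" by fastforce
    have norm_sq: "(semi_norm ?A (x, y))\<^sup>2 = (semi_norm A x)\<^sup>2 + (semi_norm A y)\<^sup>2" for x y
      by (simp add: semi_norm_sq[OF pos'] semi_norm_sq[OF pos] semi_inner_block_diag)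
    have one: "(semi_norm A u)\<^sup>2 + (semi_norm A v)\<^sup>2 = 1"
      using z norm_sq[of u v] by (simp add: uv)
    have adj: "semi_inner ?A (?T x) y = semi_inner ?A x (?T' y)" for x y
      by (simp add: semi_inner_block_diag T semi_inner_sharp_right[OF pos X]
          semi_inner_sharp_right[OF pos Y])
    \<comment> \<open>The squared seminorms of \<open>u\<close> and \<open>v\<close> sum to 1, so
      they act as the weights of a convex combination.\<close>
    have convex: "r * (semi_norm A u)\<^sup>2 + s * (semi_norm A v)\<^sup>2 \<le> max r s" for r s
    proof -
      have "r * (semi_norm A u)\<^sup>2 + s * (semi_norm A v)\<^sup>2
          \<le> max r s * (semi_norm A u)\<^sup>2 + max r s * (semi_norm A v)\<^sup>2"
        by (intro add_mono mult_right_mono) auto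
      also have "\<dots> = max r s"
        by (simp only: distrib_left[symmetric] one mult_1_right)
      finally show ?thesis .
    qed
    \<comment> \<open>Regrouped by component: \<open>X v\<close> and \<open>sharp A Y v\<close> go
      with \<open>N\<^sub>1\<close>, \<open>Y u\<close> and \<open>sharp A X u\<close> with
      \<open>N\<^sub>2\<close>.\<close>
    have "(semi_norm ?A (?T z))\<^sup>2 + (semi_norm ?A (?T' z))\<^sup>2
        \<le> N\<^sub>2 * (semi_norm A u)\<^sup>2 + N\<^sub>1 * (semi_norm A v)\<^sup>2"
      using q1(2)[of v] q2(2)[of u] by (simp add: uv T norm_sq)
    also have "\<dots> \<le> N"
      using convex[of N\<^sub>2 N\<^sub>1] by (simp add: N_def max.commute)
    finally have "((semi_norm ?A (?T z))\<^sup>2 + (semi_norm ?A (?T' z))\<^sup>2)\<^sup>2 \<le> N\<^sup>2"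
      by (intro power_mono) auto
    moreover have "(cmod (semi_inner ?A (?T (?T z)) z))\<^sup>2 \<le> W\<^sup>2"
    proof (rule power_mono)
      \<comment> \<open>The square of the off-diagonal block is diagonal, with
        \<open>X \<circ> Y\<close> acting on \<open>u\<close> and \<open>Y \<circ> X\<close> on
        \<open>v\<close>.\<close>
      have "cmod (semi_inner ?A (?T (?T z)) z)
          \<le> cmod (semi_inner A ((X \<circ> Y) u) u) + cmod (semi_inner A ((Y \<circ> X) v) v)"
        by (simp add: uv T semi_inner_block_diag norm_triangle_ineq)
      also have "\<dots> \<le> W"
        using w1(2)[of u] w2(2)[of v] convex[of W\<^sub>1 W\<^sub>2] by (simp add: W_def)
      finally show "cmod (semi_inner ?A (?T (?T z)) z) \<le> W" .
    qed simp
    ultimately have "\<delta>\<^sub>1 / 4 * ((semi_norm ?A (?T z))\<^sup>2 + (semi_norm ?A (?T' z))\<^sup>2)\<^sup>2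
        + \<delta>\<^sub>2 * (cmod (semi_inner ?A (?T (?T z)) z))\<^sup>2 \<le> \<delta>\<^sub>1 / 4 * N\<^sup>2 + \<delta>\<^sub>2 * W\<^sup>2"
      using \<delta> by (intro add_mono mult_left_mono) auto
    with semi_inner_pow4_le[OF pos' adj z assms(4,5), folded assms(6,7)] show ?thesis
      by linarith
  qed
  define B where "B = \<delta>\<^sub>1 / 4 * N\<^sup>2 + \<delta>\<^sub>2 * W\<^sup>2"
  have B: "0 \<le> B"
    using \<delta> by (simp add: B_def)
  let ?S = "insert 0 {cmod (semi_inner ?A (?T z) z) | z. semi_norm ?A z = 1}"
  \<comment> \<open>The fourth root makes the pointwise bound linear in \<open>r\<close>, so that it
    passes to the supremum; it also supplies the upper bound needed to see that the supremum is
    nonnegative.\<close>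
  have S: "r \<le> root 4 B" if "r \<in> ?S" for r
  proof -
    have "0 \<le> r \<and> r ^ 4 \<le> B"
      using that pointwise B unfolding B_def by auto
    then show ?thesis
      by (metis real_root_le_iff real_root_power_cancel zero_less_numeral)
  qed
  have "num_radius ?A ?T \<le> root 4 B"
    unfolding num_radius_def by (rule cSup_least) (use S in blast)+
  moreover have "0 \<le> num_radius ?A ?T"
    unfolding num_radius_def using bdd_aboveI[of ?S, OF S] by (rule cSup_upper[OF insertI1])
  ultimately have "num_radius ?A ?T ^ 4 \<le> root 4 B ^ 4"
    by (intro power_mono)
  also have "\<dots> = B"
    using B by simp
  finally show ?thesis
    unfolding B_def N[symmetric] W[symmetric] N\<^sub>1_def N\<^sub>2_def W\<^sub>1_def W\<^sub>2_def .
qed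

end
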